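(* There exists a sequence $\{Q_n\}_{n\in\mathbb{N}}$ of quadrature formulas on $\mathbb{S}^2$ satisfying the asymptotic approximation property for polynomials $$\lim_{n\to\infty}|Q_n(p)-I(p)|=0\quad\text{for all } p\in\mathbb{P}(\mathbb{S}^2),$$ but such that the associated degree-$n$ hyperinterpolation operators $L_n:=L_{n,Q_n}$ satisfy $\|L_ne-e\|_{L^2(\mathbb{S}^2)}=1$ for all $n\in\mathbb{N}$, where $e$ denotes the constant function $e(\mathbf{x})\equiv1$ on $\mathbb{S}^2$.
   Context: $\mathbb{S}^2=\{\mathbf{x}\in\mathbb{R}^3:\|\mathbf{x}\|_2=1\}$ carries the surface measure $\omega$ with $\omega(\mathbb{S}^2)=4\pi$; $C(\mathbb{S}^2)$ is the space of real-valued continuous functions; $L^2(\mathbb{S}^2)$ is taken with respect to $\omega$; $I(f)=\int_{\mathbb{S}^2}f\,d\omega$. $\mathbb{N}=\{1,2,\ldots\}$. $\mathbb{H}_\ell$ is the space of spherical harmonics of degree $\ell$ (restrictions to $\mathbb{S}^2$ of real harmonic homogeneous polynomials of degree $\ell$ on $\mathbb{R}^3$), $\{Y_{\ell,k}: |k|\le \ell\}$ is an $L^2(\mathbb{S}^2)$-orthonormal basis of $\mathbb{H}_\ell$, $\mathbb{P}_n(\mathbb{S}^2)=\bigoplus_{\ell=0}^n\mathbb{H}_\ell$, and $\mathbb{P}(\mathbb{S}^2)=\bigoplus_{\ell=0}^\infty\mathbb{H}_\ell$. A quadrature formula is a linear functional $Q(f)=\sum_{j=1}^N w_jf(\mathbf{x}_j)$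 on $C(\mathbb{S}^2)$ given by $N$ pairwise distinct nodes $\mathbf{x}_1,\ldots,\mathbf{x}_N\in\mathbb{S}^2$ and arbitrary real (possibly signed) weights; in a sequence $\{Q_n\}$ the nodes, weights and number of nodes may depend on $n$. The degree-$n$ hyperinterpolation operator associated with $Q$ is $L_{n,Q}:C(\mathbb{S}^2)\to\mathbb{P}_n(\mathbb{S}^2)$, $L_{n,Q}f:=\sum_{\ell=0}^n\sum_{k=-\ell}^{\ell}Q(fY_{\ell,k})\,Y_{\ell,k}$. *)

theory Defs
  imports "HOL-Analysis.Analysis"
begin

text \<open>Functions on the sphere are represented by functions on the ambient space; all notions
  below depend only on their values on the sphere.\<close>

abbreviation S2 :: "(real ^ 3) set" where
  "S2 \<equiv> sphere 0 1"

text \<open>The surface measure of a Borel set A of the unit sphere in three dimensions is three times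
  the volume of the cone of all t x with 0 < t < 1 and x in A.\<close>

definition surface_measure :: "(real ^ 3) measure" where
  "surface_measure = scale_measure 3
     (distr (restrict_space lborel (ball 0 1 - {0})) (restrict_space borel S2)
            (\<lambda>x. x /\<^sub>R norm x))"

lemma normalize_measurable:
  "(\<lambda>x. x /\<^sub>R norm x) \<in> measurable (restrict_space lborel (ball 0 1 - {0 :: real ^ 3}))
     (restrict_space borel S2)"
  by (intro measurable_restrict_space2 measurable_restrict_space1)
     (auto simp: space_restrict_space)

lemma space_surface_measure: "space surface_measure = S2"
  by (simp add: surface_measure_def space_scale_measure space_restrict_space)

lemma emeasure_surface_measure_S2: "emeasure surface_measure S2 = ennreal (4 * pi)"
proof -
  have S: "S2 \<in> sets (restrict_space borel S2)"
    by (simp add: sets_restrict_space_iff)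
  have v: "(\<lambda>x. x /\<^sub>R norm x) -` S2 \<inter> (ball 0 1 - {0 :: real ^ 3}) = ball 0 1 - {0}"
    by auto
  have "emeasure surface_measure S2 = 3 * emeasure lborel (ball 0 1 - {0 :: real ^ 3})"
    unfolding surface_measure_def
    by (simp add: emeasure_distr[OF normalize_measurable S] space_restrict_space v emeasure_restrict_space)
  also have "emeasure lborel (ball 0 1 - {0 :: real ^ 3}) = emeasure lborel (ball 0 1 :: (real ^ 3) set)"
    by (subst emeasure_Diff) auto
  also have "\<dots> = ennreal (4 / 3 * pi)"
    by (simp add: emeasure_ball unit_ball_vol_3)
  also have "3 * \<dots> = ennreal (4 * pi)"
    using ennreal_mult[of 3 "4 / 3 * pi"] by simp
  finally show ?thesis .
qed

definition sphere_integral :: "(real ^ 3 \<Rightarrow> real) \<Rightarrow> real" where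
  "sphere_integral f = integral\<^sup>L surface_measure f"

definition L2_inner :: "(real ^ 3 \<Rightarrow> real) \<Rightarrow> (real ^ 3 \<Rightarrow> real) \<Rightarrow> real" where
  "L2_inner f g = sphere_integral (\<lambda>x. f x * g x)"

definition L2_norm :: "(real ^ 3 \<Rightarrow> real) \<Rightarrow> real" where
  "L2_norm f = sqrt (sphere_integral (\<lambda>x. (f x)\<^sup>2))"

definition laplacian :: "(real ^ 3 \<Rightarrow> real) \<Rightarrow> real ^ 3 \<Rightarrow> real" where
  "laplacian f x = (\<Sum>b\<in>Basis. (deriv ^^ 2) (\<lambda>t. f (x + t *\<^sub>R b)) 0)"

definition harmonic_homogeneous_polynomial :: "nat \<Rightarrow> (real ^ 3 \<Rightarrow> real) \<Rightarrow> bool" where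
  "harmonic_homogeneous_polynomial l p \<longleftrightarrow>
     real_polynomial_function p \<and>
     (\<forall>c x. p (c *\<^sub>R x) = c ^ l * p x) \<and>
     (\<forall>x. laplacian p x = 0)"

definition spherical_harmonics :: "nat \<Rightarrow> (real ^ 3 \<Rightarrow> real) set" where
  "spherical_harmonics l =
     {f. \<exists>p. harmonic_homogeneous_polynomial l p \<and> (\<forall>x\<in>S2. f x = p x)}"

definition sphere_polynomials_upto :: "nat \<Rightarrow> (real ^ 3 \<Rightarrow> real) set" where
  "sphere_polynomials_upto n =
     {f. \<exists>g. (\<forall>l\<le>n. g l \<in> spherical_harmonics l) \<and> (\<forall>x\<in>S2. f x = (\<Sum>l\<le>n. g l x))}"

definition sphere_polynomials :: "(real ^ 3 \<Rightarrow> real) set" where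
  "sphere_polynomials = (\<Union>n. sphere_polynomials_upto n)"

definition orthonormal_basis_of_harmonics :: "nat \<Rightarrow> (int \<Rightarrow> real ^ 3 \<Rightarrow> real) \<Rightarrow> bool" where
  "orthonormal_basis_of_harmonics l y \<longleftrightarrow>
     (\<forall>k\<in>{- int l..int l}. y k \<in> spherical_harmonics l) \<and>
     (\<forall>j\<in>{- int l..int l}. \<forall>k\<in>{- int l..int l}.
        L2_inner (y j) (y k) = (if j = k then 1 else 0)) \<and>
     (\<forall>f\<in>spherical_harmonics l. \<exists>c. \<forall>x\<in>S2. f x = (\<Sum>k=- int l..int l. c k * y k x))"

text \<open>A quadrature formula is a functional on continuous functions on the sphere; its values on
  other functions are left unconstrained.\<close>

definition quadrature_formula :: "((real ^ 3 \<Rightarrow> real) \<Rightarrow> real) \<Rightarrow> bool" where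
  "quadrature_formula Q \<longleftrightarrow>
     (\<exists>N\<ge>1. \<exists>(x :: nat \<Rightarrow> real ^ 3) (w :: nat \<Rightarrow> real).
        inj_on x {1..N} \<and> x ` {1..N} \<subseteq> S2 \<and>
        (\<forall>f. continuous_on S2 f \<longrightarrow> Q f = (\<Sum>j=1..N. w j * f (x j))))"

definition hyperinterpolation ::
  "(nat \<Rightarrow> int \<Rightarrow> real ^ 3 \<Rightarrow> real) \<Rightarrow> nat \<Rightarrow> ((real ^ 3 \<Rightarrow> real) \<Rightarrow> real) \<Rightarrow>
   (real ^ 3 \<Rightarrow> real) \<Rightarrow> real ^ 3 \<Rightarrow> real" where
  "hyperinterpolation Y n Q f x =
     (\<Sum>l=0..n. \<Sum>k=- int l..int l. Q (\<lambda>z. f z * Y l k z) * Y l k x)"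

end

theory Submission
  imports Defs
begin

text \<open>Let \<open>1 = c Y\<^sub>0\<^sub>0\<close> on the sphere. Choose \<open>Q\<^sub>n\<close> with the values \<open>c\<close> on \<open>Y\<^sub>0\<^sub>0\<close>, \<open>1\<close> on
  \<open>Y\<^sub>n\<^sub>0\<close>, and \<open>0\<close> on all other basis functions of degree at most \<open>n\<close>; then \<open>L\<^sub>n e - e = Y\<^sub>n\<^sub>0\<close>.
  Point evaluations span the dual of a finite-dimensional function space, so such a quadrature
  formula exists once harmonics of different degrees are known to be linearly independent on the
  sphere; this follows from the maximum principle and homogeneity.

  As \<open>Q\<^sub>n\<close> is the integral on polynomials of degree below \<open>n\<close>, it remains that harmonics of
  degree \<open>l \<ge> 1\<close> have integral zero. The integral is represented on degree \<open>l\<close> by an inner product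
  with some harmonic \<open>z\<close> of the same degree. Rotation invariance of the measure makes \<open>z\<close> rotation
  invariant, hence constant on the sphere, and independence from the constants of degree \<open>0\<close> forces
  \<open>z = 0\<close>.\<close>

subsection \<open>Harmonic polynomials\<close>

text \<open>Induction on the generation of polynomials, with the product rule for products. The
  partial derivatives \<open>g b\<close> are polynomials again, so the lemma can be iterated; the
  direction \<open>v\<close> is arbitrary so that rotated basis vectors are covered as well.\<close>

lemma polynomial_gradient:
  fixes p :: "'a::euclidean_space \<Rightarrow> real"
  assumes "real_polynomial_function p"
  shows "\<exists>g. (\<forall>b. real_polynomial_function (g b)) \<and>
    (\<forall>x v t. ((\<lambda>s. p (x + s *\<^sub>R v)) has_real_derivative
       (\<Sum>b\<in>Basis. (v \<bullet> b) * g b (x + t *\<^sub>R v))) (at t))"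
  using assms
proof (induction rule: real_polynomial_function.induct)
  case (linear f)
  interpret f: bounded_linear f by (rule linear)
  have f_eq: "f v = (\<Sum>b\<in>Basis. (v \<bullet> b) * f b)" for v
  proof -
    have "f v = f (\<Sum>b\<in>Basis. (v \<bullet> b) *\<^sub>R b)"
      by (simp add: euclidean_representation)
    also have "\<dots> = (\<Sum>b\<in>Basis. (v \<bullet> b) * f b)"
      by (simp add: f.sum f.scaleR)
    finally show ?thesis .
  qed
  have "((\<lambda>s. f (x + s *\<^sub>R v)) has_real_derivative f v) (at t)" for x v t
    unfolding f.add f.scaleR by (auto intro!: derivative_eq_intros)
  from DERIV_cong[OF this f_eq] show ?case
    by (intro exI[of _ "\<lambda>b x. f b"] conjI allI real_polynomial_function.intros(2))
next
  case (const c)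
  show ?case
    by (intro exI[of _ "\<lambda>b x. 0"] conjI allI real_polynomial_function.intros(2)) simp
next
  case (add f h)
  then obtain a b where ab:
    "\<And>i. real_polynomial_function (a i)" "\<And>i. real_polynomial_function (b i)"
    "\<And>x v t. ((\<lambda>s. f (x + s *\<^sub>R v)) has_real_derivative
       (\<Sum>i\<in>Basis. (v \<bullet> i) * a i (x + t *\<^sub>R v))) (at t)"
    "\<And>x v t. ((\<lambda>s. h (x + s *\<^sub>R v)) has_real_derivative
       (\<Sum>i\<in>Basis. (v \<bullet> i) * b i (x + t *\<^sub>R v))) (at t)"
    by blast
  show ?case
    by (intro exI[of _ "\<lambda>i x. a i x + b i x"] conjI allI real_polynomial_function.intros(3) ab
        DERIV_cong[OF DERIV_add[OF ab(3,4)]])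
       (simp add: sum.distrib distrib_left)
next
  case (mult f h)
  then obtain a b where ab:
    "\<And>i. real_polynomial_function (a i)" "\<And>i. real_polynomial_function (b i)"
    "\<And>x v t. ((\<lambda>s. f (x + s *\<^sub>R v)) has_real_derivative
       (\<Sum>i\<in>Basis. (v \<bullet> i) * a i (x + t *\<^sub>R v))) (at t)"
    "\<And>x v t. ((\<lambda>s. h (x + s *\<^sub>R v)) has_real_derivative
       (\<Sum>i\<in>Basis. (v \<bullet> i) * b i (x + t *\<^sub>R v))) (at t)"
    by blast
  show ?case
    by (intro exI[of _ "\<lambda>i x. f x * b i x + a i x * h x"] conjI allI
        real_polynomial_function.intros(3,4) ab mult.hyps DERIV_cong[OF DERIV_mult[OF ab(3,4)]])
       (simp add: sum.distrib sum_distrib_left sum_distrib_right distrib_left ac_simps)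
qed

text \<open>Two applications of the gradient lemma. Since \<open>H\<close> does not depend on
  \<open>v\<close>, second derivatives in all directions come from one quadratic form at
  \<open>x\<close>.\<close>

lemma polynomial_hessian:
  fixes p :: "'a::euclidean_space \<Rightarrow> real"
  assumes "real_polynomial_function p"
  shows "\<exists>H. \<forall>x v. (deriv ^^ 2) (\<lambda>t. p (x + t *\<^sub>R v)) 0 =
    (\<Sum>b\<in>Basis. \<Sum>c\<in>Basis. (v \<bullet> b) * (v \<bullet> c) * H b c x)"
proof -
  obtain g where g: "\<And>b. real_polynomial_function (g b)"
    and dg: "\<And>x v t. ((\<lambda>s. p (x + s *\<^sub>R v)) has_real_derivative
       (\<Sum>b\<in>Basis. (v \<bullet> b) * g b (x + t *\<^sub>R v))) (at t)"
    using polynomial_gradient[OF assms] by blast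
  have "\<forall>b. \<exists>h. \<forall>x v t. ((\<lambda>s. g b (x + s *\<^sub>R v)) has_real_derivative
       (\<Sum>c\<in>Basis. (v \<bullet> c) * h c (x + t *\<^sub>R v))) (at t)"
    using polynomial_gradient[OF g] by blast
  then obtain H where H: "\<And>b x v t. ((\<lambda>s. g b (x + s *\<^sub>R v)) has_real_derivative
       (\<Sum>c\<in>Basis. (v \<bullet> c) * H b c (x + t *\<^sub>R v))) (at t)"
    by metis
  have "(deriv ^^ 2) (\<lambda>t. p (x + t *\<^sub>R v)) 0 =
    (\<Sum>b\<in>Basis. \<Sum>c\<in>Basis. (v \<bullet> b) * (v \<bullet> c) * H b c x)" for x v
  proof -
    have 1: "deriv (\<lambda>t. p (x + t *\<^sub>R v)) = (\<lambda>t. \<Sum>b\<in>Basis. (v \<bullet> b) * g b (x + t *\<^sub>R v))"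
      by (rule ext) (rule DERIV_imp_deriv[OF dg])
    have "((\<lambda>t. \<Sum>b\<in>Basis. (v \<bullet> b) * g b (x + t *\<^sub>R v)) has_real_derivative
        (\<Sum>b\<in>Basis. (v \<bullet> b) * (\<Sum>c\<in>Basis. (v \<bullet> c) * H b c (x + 0 *\<^sub>R v)))) (at 0)"
      by (intro DERIV_sum DERIV_cmult H)
    from DERIV_imp_deriv[OF this] show ?thesis
      by (simp add: numeral_2_eq_2 1 sum_distrib_left mult.assoc)
  qed
  then show ?thesis
    by blast
qed

lemma polynomial_function_on_line:
  fixes p :: "'a::euclidean_space \<Rightarrow> real"
  assumes "real_polynomial_function p"
  shows "real_polynomial_function (\<lambda>t. p (x + t *\<^sub>R v))"
  using assms
proof (induction rule: real_polynomial_function.induct)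
  case (linear f)
  interpret f: bounded_linear f by (rule linear)
  have "bounded_linear (\<lambda>t. t * f v)"
    by (rule bounded_linear_mult_left)
  then show ?case
    by (auto simp: f.add f.scaleR)
qed auto

lemma second_derivative_linear:
  fixes p q :: "real \<Rightarrow> real"
  assumes "real_polynomial_function p" "real_polynomial_function q"
  shows "(deriv ^^ 2) (\<lambda>t. a * p t + b * q t) 0 = a * (deriv ^^ 2) p 0 + b * (deriv ^^ 2) q 0"
proof -
  obtain p' q' where 1: "real_polynomial_function p'" "real_polynomial_function q'"
    "\<And>x. (p has_real_derivative p' x) (at x)" "\<And>x. (q has_real_derivative q' x) (at x)"
    using has_real_derivative_polynomial_function assms by metis
  obtain p'' q'' where 2:
    "\<And>x. (p' has_real_derivative p'' x) (at x)" "\<And>x. (q' has_real_derivative q'' x) (at x)"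
    using has_real_derivative_polynomial_function 1(1,2) by metis
  have "((\<lambda>t. a * p t + b * q t) has_real_derivative a * p' x + b * q' x) (at x)"
    "((\<lambda>t. a * p' t + b * q' t) has_real_derivative a * p'' x + b * q'' x) (at x)" for x
    using 1 2 by (auto intro!: derivative_eq_intros)
  then have "deriv (\<lambda>t. a * p t + b * q t) = (\<lambda>t. a * p' t + b * q' t)"
    "deriv (\<lambda>t. a * p' t + b * q' t) = (\<lambda>t. a * p'' t + b * q'' t)"
    by (auto intro!: DERIV_imp_deriv)
  moreover have "deriv p = p'" "deriv q = q'" "deriv p' = p''" "deriv q' = q''"
    using 1 2 by (auto intro!: DERIV_imp_deriv)
  ultimately show ?thesis
    by (simp add: numeral_2_eq_2)
qed

section \<open>Linearity and rotation invariance of the Laplacian\<close>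

lemma laplacian_linear:
  assumes "real_polynomial_function p" "real_polynomial_function q"
  shows "laplacian (\<lambda>x. a * p x + b * q x) x = a * laplacian p x + b * laplacian q x"
  unfolding laplacian_def
  by (subst second_derivative_linear)
     (auto intro!: polynomial_function_on_line assms simp: sum.distrib sum_distrib_left)

lemma laplacian_const: "laplacian (\<lambda>_. c) x = 0"
  by (simp add: laplacian_def numeral_2_eq_2)

lemma laplacian_sum:
  assumes "finite A" "\<And>i. i \<in> A \<Longrightarrow> real_polynomial_function (p i)"
  shows "laplacian (\<lambda>x. \<Sum>i\<in>A. c i * p i x) x = (\<Sum>i\<in>A. c i * laplacian (p i) x)"
  using assms
proof (induction A rule: finite_induct)
  case empty
  then show ?case by (simp add: laplacian_const)
next
  case (insert i A)
  have "laplacian (\<lambda>x. c i * p i x + 1 * (\<Sum>i\<in>A. c i * p i x)) x =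
      c i * laplacian (p i) x + 1 * laplacian (\<lambda>x. \<Sum>i\<in>A. c i * p i x) x"
    using insert
    by (intro laplacian_linear real_polynomial_function_sum real_polynomial_function.intros(2,4)) auto
  with insert show ?case
    by simp
qed

lemma real_polynomial_function_inner_self:
  "real_polynomial_function (\<lambda>x::'a::euclidean_space. x \<bullet> x)"
proof -
  have "real_polynomial_function (\<lambda>x::'a. \<Sum>b\<in>Basis. (x \<bullet> b) * (x \<bullet> b))"
    by (intro real_polynomial_function_sum real_polynomial_function.intros(1,4)
        bounded_linear_inner_left) auto
  then show ?thesis
    by (simp add: euclidean_inner[symmetric])
qed

text \<open>The value is twice the dimension. Being strictly positive, it makes the squared norm a
  suitable perturbation for the maximum principle.\<close>

lemma laplacian_inner_self: "laplacian (\<lambda>x. x \<bullet> x) x = 6"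
proof -
  have "(deriv ^^ 2) (\<lambda>t. (x + t *\<^sub>R b) \<bullet> (x + t *\<^sub>R b)) 0 = 2" if "b \<in> Basis" for b
  proof -
    have e: "(\<lambda>t. (x + t *\<^sub>R b) \<bullet> (x + t *\<^sub>R b)) = (\<lambda>t. x \<bullet> x + 2 * t * (x \<bullet> b) + t\<^sup>2)"
      using that by (auto simp: inner_add inner_commute power2_eq_square algebra_simps)
    have "deriv (\<lambda>t. x \<bullet> x + 2 * t * (x \<bullet> b) + t\<^sup>2) = (\<lambda>t. 2 * (x \<bullet> b) + 2 * t)"
      by (rule ext, rule DERIV_imp_deriv) (auto intro!: derivative_eq_intros)
    moreover have "deriv (\<lambda>t. 2 * (x \<bullet> b) + 2 * t) 0 = 2"
      by (rule DERIV_imp_deriv) (auto intro!: derivative_eq_intros)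
    ultimately show ?thesis
      by (simp add: e numeral_2_eq_2)
  qed
  then show ?thesis
    unfolding laplacian_def by simp
qed

text \<open>The Laplacian is the trace of the Hessian form, and this trace can equally be computed
  in the orthonormal basis of the vectors \<open>R b\<close>.\<close>

lemma laplacian_orthogonal_transformation:
  assumes p: "real_polynomial_function p" and R: "orthogonal_transformation R"
  shows "laplacian (\<lambda>x. p (R x)) x = laplacian p (R x)"
proof -
  obtain H where H: "\<And>x v. (deriv ^^ 2) (\<lambda>t. p (x + t *\<^sub>R v)) 0 =
    (\<Sum>b\<in>Basis. \<Sum>c\<in>Basis. (v \<bullet> b) * (v \<bullet> c) * H b c x)"
    using polynomial_hessian[OF p] by blast
  have lin: "linear R"
    using R by (rule orthogonal_transformation_linear)
  \<comment> \<open>The inverse of an orthogonal map is its adjoint.\<close>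
  have adj: "R b \<bullet> c = b \<bullet> inv R c" for b c
    using R orthogonal_transformation_surj[OF R]
    by (metis orthogonal_transformation_def surj_f_inv_f)
  \<comment> \<open>Parseval's identity for \<open>inv R c\<close> and \<open>inv R d\<close>,
    followed by orthogonality of \<open>inv R\<close>.\<close>
  have tr: "(\<Sum>b\<in>Basis. (R b \<bullet> c) * (R b \<bullet> d)) = c \<bullet> d" for c d
  proof -
    have "(\<Sum>b\<in>Basis. (R b \<bullet> c) * (R b \<bullet> d)) = inv R c \<bullet> inv R d"
      unfolding euclidean_inner[of "inv R c" "inv R d"] adj by (simp only: inner_commute)
    also have "\<dots> = c \<bullet> d"
      using orthogonal_transformation_inv[OF R] by (simp add: orthogonal_transformation_def)
    finally show ?thesis .
  qed
  have "laplacian (\<lambda>x. p (R x)) x = (\<Sum>b\<in>Basis. (deriv ^^ 2) (\<lambda>t. p (R x + t *\<^sub>R R b)) 0)"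
    unfolding laplacian_def using lin by (simp add: linear_add linear_scale)
  also have "\<dots> = (\<Sum>b\<in>Basis. \<Sum>c\<in>Basis. \<Sum>d\<in>Basis. (R b \<bullet> c) * (R b \<bullet> d) * H c d (R x))"
    by (simp add: H)
  also have "\<dots> = (\<Sum>c\<in>Basis. \<Sum>b\<in>Basis. \<Sum>d\<in>Basis. (R b \<bullet> c) * (R b \<bullet> d) * H c d (R x))"
    by (rule sum.swap)
  also have "\<dots> = (\<Sum>c\<in>Basis. \<Sum>d\<in>Basis. \<Sum>b\<in>Basis. (R b \<bullet> c) * (R b \<bullet> d) * H c d (R x))"
    by (intro sum.cong refl sum.swap)
  also have "\<dots> = (\<Sum>c\<in>Basis. \<Sum>d\<in>Basis. (c \<bullet> d) * H c d (R x))"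
    by (simp add: tr sum_distrib_right[symmetric])
  also have "\<dots> = (\<Sum>c\<in>Basis. H c c (R x))"
    by (intro sum.cong refl) (simp add: inner_Basis if_distrib[of "\<lambda>t. t * _"] cong: if_cong)
  also have "\<dots> = laplacian p (R x)"
    unfolding laplacian_def H
    by (intro sum.cong refl)
       (simp add: inner_Basis if_distrib[of "\<lambda>t. t * _"] if_distrib[of "\<lambda>t. _ * t"] cong: if_cong)
  finally show ?thesis .
qed

section \<open>Maximum principle and independence of different degrees\<close>

lemma local_max_second_derivative_nonpos:
  fixes f :: "real \<Rightarrow> real"
  assumes f: "real_polynomial_function f" and e: "e > 0"
    and max: "\<And>t. \<bar>t\<bar> < e \<Longrightarrow> f t \<le> f 0"
  shows "(deriv ^^ 2) f 0 \<le> 0"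
proof (rule ccontr)
  obtain f' where f': "real_polynomial_function f'" "\<And>x. (f has_real_derivative f' x) (at x)"
    using has_real_derivative_polynomial_function f by metis
  obtain f'' where f'': "\<And>x. (f' has_real_derivative f'' x) (at x)"
    using has_real_derivative_polynomial_function f'(1) by metis
  have "deriv f = f'" "deriv f' = f''"
    using f' f'' by (auto intro!: DERIV_imp_deriv)
  moreover assume "\<not> (deriv ^^ 2) f 0 \<le> 0"
  ultimately have "f'' 0 > 0"
    by (simp add: numeral_2_eq_2)
  then obtain d where d: "d > 0" "\<And>h. 0 < h \<Longrightarrow> h < d \<Longrightarrow> f' 0 < f' (0 + h)"
    using DERIV_pos_inc_right[OF f''] by metis
  \<comment> \<open>With a critical point at \<open>0\<close> and \<open>f'' 0 > 0\<close>, the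
    derivative is positive just to the right of \<open>0\<close>, so \<open>f\<close> would increase
    there.\<close>
  have f'0: "f' 0 = 0"
    using max by (intro DERIV_local_max[OF f'(2) e]) auto
  define h where "h = min d e / 2"
  have h: "0 < h" "h < d" "h < e"
    using d(1) e by (auto simp: h_def)
  have "f 0 < f h"
  proof (rule DERIV_pos_imp_increasing_open[OF h(1)])
    show "\<exists>y. (f has_real_derivative y) (at x) \<and> y > 0" if "0 < x" "x < h" for x
      using f'(2) d(2)[of x] that h f'0 by auto
    show "continuous_on {0..h} f"
      using f'(2) by (meson DERIV_isCont continuous_at_imp_continuous_on)
  qed
  with max[of h] h show False
    by auto
qed

text \<open>A small multiple of the squared norm is added to \<open>h\<close>. The Laplacian becomes
  strictly positive, which excludes an interior maximum, while a positive value of \<open>h\<close>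
  would force one.\<close>

lemma harmonic_polynomial_le_0:
  assumes h: "real_polynomial_function h" and lap: "\<And>x. laplacian h x = 0"
    and bd: "\<And>x. x \<in> S2 \<Longrightarrow> h x = 0" and x0: "norm x0 < 1"
  shows "h x0 \<le> 0"
proof (rule ccontr)
  assume "\<not> h x0 \<le> 0"
  then have pos: "h x0 > 0" by simp
  \<comment> \<open>With this choice \<open>g\<close> equals \<open>e\<close> on the sphere, whereas
    \<open>g x0\<close> is at least \<open>h x0 = 2 * e\<close>; hence the maximum over the closed
    ball is attained inside.\<close>
  define e where "e = h x0 / 2"
  define g where "g = (\<lambda>x. 1 * h x + e * (x \<bullet> x))"
  have e: "e > 0" using pos by (simp add: e_def)
  have g: "real_polynomial_function g"
    unfolding g_def using h real_polynomial_function_inner_self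
    by (intro real_polynomial_function.intros(2-4))
  have lapg: "laplacian g x = 6 * e" for x
    unfolding g_def
    by (subst laplacian_linear[OF h real_polynomial_function_inner_self])
       (simp add: lap laplacian_inner_self)
  have "continuous_on (cball 0 1) g"
    using continuous_real_polymonial_function[OF g] continuous_at_imp_continuous_on by blast
  then obtain x1 where x1: "x1 \<in> cball 0 1" and max: "\<And>y. y \<in> cball 0 1 \<Longrightarrow> g y \<le> g x1"
    using continuous_attains_sup[of "cball 0 1" g] by (auto simp: Ball_def)
  have "g x0 > e"
    using pos x0 e by (auto simp: g_def e_def) (smt (verit) mult_nonneg_nonneg inner_ge_zero)
  then have "g x1 > e"
    using max[of x0] x0 by (simp add: less_imp_le)
  moreover have "g x = e" if "norm x = 1" for x
    using that bd[of x] by (simp add: g_def dot_square_norm)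
  ultimately have nx1: "norm x1 < 1"
    using x1 by (cases "norm x1 = 1") auto
  have "(deriv ^^ 2) (\<lambda>t. g (x1 + t *\<^sub>R b)) 0 \<le> 0" if b: "b \<in> Basis" for b
  proof (rule local_max_second_derivative_nonpos)
    show "real_polynomial_function (\<lambda>t. g (x1 + t *\<^sub>R b))"
      by (rule polynomial_function_on_line[OF g])
    show "1 - norm x1 > 0" using nx1 by simp
    show "g (x1 + t *\<^sub>R b) \<le> g (x1 + 0 *\<^sub>R b)" if "\<bar>t\<bar> < 1 - norm x1" for t
    proof -
      have "norm (x1 + t *\<^sub>R b) \<le> norm x1 + \<bar>t\<bar>"
        using norm_triangle_ineq[of x1 "t *\<^sub>R b"] b by simp
      then show ?thesis
        using max[of "x1 + t *\<^sub>R b"] that by simp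
    qed
  qed
  then have "laplacian g x1 \<le> 0"
    unfolding laplacian_def by (rule sum_nonpos)
  with lapg e show False
    by simp
qed

text \<open>The one-sided bound is applied to \<open>h\<close> and to \<open>- h\<close>.\<close>

lemma harmonic_polynomial_eq_0:
  assumes h: "real_polynomial_function h" and lap: "\<And>x. laplacian h x = 0"
    and bd: "\<And>x. x \<in> S2 \<Longrightarrow> h x = 0" and x0: "norm x0 < 1"
  shows "h x0 = 0"
proof (rule antisym)
  show "h x0 \<le> 0"
    using assms by (rule harmonic_polynomial_le_0)
  have "- h x0 \<le> 0"
  proof (rule harmonic_polynomial_le_0[OF _ _ _ x0])
    show "laplacian (\<lambda>x. - h x) x = 0" for x
      using laplacian_linear[OF h h, of "-1" 0] lap by simp
  qed (use h bd in auto)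
  then show "0 \<le> h x0" by simp
qed

text \<open>The sum vanishes inside the ball by the maximum principle. Along the ray through
  \<open>x\<close>, homogeneity turns it into a polynomial in the radius whose coefficients are the
  values \<open>p l x\<close>.\<close>

lemma harmonic_homogeneous_independent:
  fixes p :: "nat \<Rightarrow> real ^ 3 \<Rightarrow> real"
  assumes p: "\<And>l. l \<le> n \<Longrightarrow> harmonic_homogeneous_polynomial l (p l)"
    and zero: "\<And>x. x \<in> S2 \<Longrightarrow> (\<Sum>l\<le>n. p l x) = 0"
    and x: "x \<in> S2" and l: "l \<le> n"
  shows "p l x = 0"
proof -
  define h where "h = (\<lambda>x. \<Sum>l\<le>n. 1 * p l x)"
  have rp: "real_polynomial_function (p l)" and lp: "laplacian (p l) x = 0"
    and hom: "p l (c *\<^sub>R x) = c ^ l * p l x" if "l \<le> n" for l x c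
    using p[OF that] by (auto simp: harmonic_homogeneous_polynomial_def)
  have h: "real_polynomial_function h"
    unfolding h_def using rp by auto
  have lap: "laplacian h x = 0" for x
    unfolding h_def by (subst laplacian_sum) (auto simp: rp lp)
  have h0: "h (c *\<^sub>R x) = 0" if "\<bar>c\<bar> < 1" for c
  proof (rule harmonic_polynomial_eq_0[OF h lap])
    show "h y = 0" if "y \<in> S2" for y
      using zero[OF that] by (simp add: h_def)
    show "norm (c *\<^sub>R x) < 1"
      using x that by simp
  qed
  have "(\<Sum>l\<le>n. p l x * c ^ l) = 0" if "\<bar>c\<bar> < 1" for c
  proof -
    have "(\<Sum>l\<le>n. p l x * c ^ l) = h (c *\<^sub>R x)"
      unfolding h_def by (intro sum.cong refl) (simp add: hom)
    with h0[OF that] show ?thesis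
      by simp
  qed
  \<comment> \<open>A polynomial in \<open>c\<close> with a whole interval of roots has only zero
    coefficients.\<close>
  then have "{-1<..<1} \<subseteq> {c. (\<Sum>l\<le>n. p l x * c ^ l) = 0}"
    by (auto simp: abs_less_iff)
  then have "infinite {c. (\<Sum>l\<le>n. p l x * c ^ l) = 0}"
    by (rule infinite_super) (simp add: infinite_Ioo)
  then show ?thesis
    using polyfun_finite_roots[of "\<lambda>l. p l x" n] l by auto
qed

subsection \<open>Rotation invariance of the surface measure\<close>

text \<open>Lebesgue measure on Borel sets is determined by its values on boxes, so it suffices that
  orthogonal images of boxes keep their volume.\<close>

lemma emeasure_lborel_vimage_orthogonal:
  fixes R :: "real ^ 'n::{finite,wellorder} \<Rightarrow> real ^ 'n::_"
  assumes R: "orthogonal_transformation R" and B: "B \<in> sets borel"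
  shows "emeasure lborel (R -` B) = emeasure lborel B"
proof -
  have cont: "continuous_on UNIV f" if "orthogonal_transformation f"
    for f :: "real ^ 'n::{finite,wellorder} \<Rightarrow> real ^ 'n::_"
    using orthogonal_transformation_linear[OF that] by (simp add: linear_continuous_on linear_linear)
  have meas: "R \<in> borel \<rightarrow>\<^sub>M borel"
    using cont[OF R] by (rule borel_measurable_continuous_onI)
  have vim: "R -` C = inv R ` C" for C
    using orthogonal_transformation_bij[OF R] by (rule bij_vimage_eq_inv_image)
  have "lborel = distr lborel borel R"
  proof (rule lborel_eqI)
    fix l u :: "real ^ 'n::{finite,wellorder}"
    assume le: "\<And>b. b \<in> Basis \<Longrightarrow> l \<bullet> b \<le> u \<bullet> b"
    have box: "inv R ` box l u \<in> lmeasurable"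
      "measure lebesgue (inv R ` box l u) = measure lebesgue (box l u)"
      using measurable_orthogonal_image[OF orthogonal_transformation_inv[OF R] lmeasurable_box]
        measure_orthogonal_image[OF orthogonal_transformation_inv[OF R] lmeasurable_box]
      by blast+
    \<comment> \<open>Openness makes the rotated box a Borel set, on which \<open>lborel\<close> and
      its completion \<open>lebesgue\<close> agree.\<close>
    have op: "open (inv R ` box l u)"
      unfolding vim[symmetric] using cont[OF R] by (intro open_vimage) auto
    have "emeasure (distr lborel borel R) (box l u) = emeasure lborel (inv R ` box l u)"
      using meas by (simp add: emeasure_distr vim)
    also have "\<dots> = emeasure lebesgue (inv R ` box l u)"
      using op by simp
    also have "\<dots> = ennreal (measure lebesgue (box l u))"
      unfolding emeasure_eq_measure2[OF box(1)] box(2) ..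
    also have "\<dots> = emeasure lborel (box l u)"
      using emeasure_eq_ennreal_measure[of lborel "box l u"] emeasure_lborel_box_finite[of l u]
      by (simp add: less_top)
    finally show "emeasure (distr lborel borel R) (box l u) = (\<Prod>b\<in>Basis. (u - l) \<bullet> b)"
      by (simp add: le)
  qed simp
  then have "emeasure lborel B = emeasure (distr lborel borel R) B"
    by simp
  also have "\<dots> = emeasure lborel (R -` B)"
    using meas B by (simp add: emeasure_distr)
  finally show ?thesis ..
qed

lemma sets_surface_measure [measurable_cong]: "sets surface_measure = sets (restrict_space borel S2)"
  by (simp add: surface_measure_def)

lemma emeasure_surface_measure:
  assumes "A \<in> sets surface_measure"
  shows "emeasure surface_measure A =
    3 * emeasure lborel ((\<lambda>x. x /\<^sub>R norm x) -` A \<inter> (ball 0 1 - {0}))"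
proof -
  let ?D = "ball 0 1 - {0 :: real ^ 3}"
  have A: "A \<in> sets (restrict_space borel S2)"
    using assms by (simp only: sets_surface_measure)
  have "emeasure surface_measure A = 3 * emeasure (restrict_space lborel ?D)
      ((\<lambda>x. x /\<^sub>R norm x) -` A \<inter> space (restrict_space lborel ?D))"
    unfolding surface_measure_def emeasure_scale_measure emeasure_distr[OF normalize_measurable A] ..
  also have "space (restrict_space lborel ?D) = ?D"
    by (simp add: space_restrict_space)
  also have "emeasure (restrict_space lborel ?D) ((\<lambda>x. x /\<^sub>R norm x) -` A \<inter> ?D) =
      emeasure lborel ((\<lambda>x. x /\<^sub>R norm x) -` A \<inter> ?D)"
    by (rule emeasure_restrict_space) auto
  finally show ?thesis .
qed

lemma orthogonal_transformation_measurable_surface_measure: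
  assumes "orthogonal_transformation R"
  shows "R \<in> surface_measure \<rightarrow>\<^sub>M surface_measure"
proof -
  have "R \<in> restrict_space borel S2 \<rightarrow>\<^sub>M restrict_space borel S2"
  proof (rule measurable_restrict_space3)
    show "R \<in> borel \<rightarrow>\<^sub>M borel"
      using orthogonal_transformation_linear[OF assms]
      by (intro borel_measurable_continuous_onI) (simp add: linear_continuous_on linear_linear)
    show "R \<in> S2 \<rightarrow> S2"
      using assms by (auto simp: orthogonal_transformation_norm)
  qed
  then show ?thesis
    using measurable_cong_sets[OF sets_surface_measure sets_surface_measure] by blast
qed

text \<open>Up to the factor \<open>3\<close>, the surface measure of a set is the volume of the
  cone over it, so the invariance of volume carries over.\<close>

lemma distr_surface_measure_orthogonal:
  assumes R: "orthogonal_transformation R"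
  shows "distr surface_measure surface_measure R = surface_measure"
proof (rule measure_eqI)
  fix A assume "A \<in> sets (distr surface_measure surface_measure R)"
  then have A: "A \<in> sets surface_measure" by simp
  note meas = orthogonal_transformation_measurable_surface_measure[OF R]
  let ?C = "\<lambda>A. (\<lambda>x. x /\<^sub>R norm x) -` A \<inter> (ball 0 1 - {0})"
  have "?C A \<in> sets (restrict_space lborel (ball 0 1 - {0}))"
    using measurable_sets[OF normalize_measurable] A
    by (simp add: sets_surface_measure space_restrict_space)
  then have CA: "?C A \<in> sets borel"
    by (subst (asm) sets_restrict_space_iff) auto
  have "emeasure (distr surface_measure surface_measure R) A =
      emeasure surface_measure (R -` A \<inter> S2)"
    using meas A by (simp add: emeasure_distr space_surface_measure)
  also have "\<dots> = 3 * emeasure lborel (?C (R -` A \<inter> S2))"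
    using measurable_sets[OF meas A]
    by (intro emeasure_surface_measure) (simp add: space_surface_measure)
  \<comment> \<open>\<open>R\<close> is linear and preserves norms, so it commutes with radial
    projection and maps the punctured ball to itself.\<close>
  also have "?C (R -` A \<inter> S2) = R -` ?C A"
  proof -
    have "R x = 0 \<longleftrightarrow> x = 0" "R (x /\<^sub>R norm x) = R x /\<^sub>R norm x" for x
      using orthogonal_transformation_linear[OF R] orthogonal_transformation_norm[OF R]
      by (metis norm_eq_zero, metis linear_scale)
    then show ?thesis
      by (auto simp: orthogonal_transformation_norm[OF R])
  qed
  also have "3 * emeasure lborel \<dots> = 3 * emeasure lborel (?C A)"
    unfolding emeasure_lborel_vimage_orthogonal[OF R CA] ..
  also have "\<dots> = emeasure surface_measure A"
    using A by (rule emeasure_surface_measure[symmetric])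
  finally show "emeasure (distr surface_measure surface_measure R) A = emeasure surface_measure A" .
qed simp

section \<open>Integration of continuous functions over the sphere\<close>

lemma finite_measure_surface_measure: "finite_measure surface_measure"
  by (rule finite_measureI) (simp add: space_surface_measure emeasure_surface_measure_S2)

lemma measurable_surface_measure_continuous:
  fixes f :: "real ^ 3 \<Rightarrow> real"
  assumes "continuous_on S2 f"
  shows "f \<in> borel_measurable surface_measure"
  using borel_measurable_continuous_on_restrict[OF assms]
  unfolding measurable_cong_sets[OF sets_surface_measure refl] .

lemma integrable_surface_measure_continuous:
  fixes f :: "real ^ 3 \<Rightarrow> real"
  assumes "continuous_on S2 f"
  shows "integrable surface_measure f"
proof -
  interpret finite_measure surface_measure
    by (rule finite_measure_surface_measure)
  have "bounded (f ` S2)"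
    using assms by (intro compact_imp_bounded compact_continuous_image) auto
  then obtain B where "\<And>x. x \<in> S2 \<Longrightarrow> norm (f x) \<le> B"
    unfolding bounded_iff by blast
  then show ?thesis
    using measurable_surface_measure_continuous[OF assms]
    by (intro integrable_const_bound[where B = B] AE_I2) (auto simp: space_surface_measure)
qed

lemma sphere_integral_cong:
  assumes "\<And>x. x \<in> S2 \<Longrightarrow> f x = g x"
  shows "sphere_integral f = sphere_integral g"
  unfolding sphere_integral_def
  using assms by (intro Bochner_Integration.integral_cong) (auto simp: space_surface_measure)

lemma L2_inner_cong:
  assumes "\<And>x. x \<in> S2 \<Longrightarrow> f x = f' x" "\<And>x. x \<in> S2 \<Longrightarrow> g x = g' x"
  shows "L2_inner f g = L2_inner f' g'"
  unfolding L2_inner_def using assms by (intro sphere_integral_cong) auto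

text \<open>The coefficients are built in so that basis expansions are covered directly, and plain
  sums with coefficient \<open>1\<close>.\<close>

lemma sphere_integral_sum:
  assumes "\<And>i. i \<in> A \<Longrightarrow> continuous_on S2 (f i)"
  shows "sphere_integral (\<lambda>x. \<Sum>i\<in>A. c i * f i x) = (\<Sum>i\<in>A. c i * sphere_integral (f i))"
  unfolding sphere_integral_def
  using assms
  by (subst Bochner_Integration.integral_sum) (auto intro: integrable_surface_measure_continuous)

lemma L2_inner_sum_left:
  assumes "\<And>i. i \<in> A \<Longrightarrow> continuous_on S2 (f i)" "continuous_on S2 g"
  shows "L2_inner (\<lambda>x. \<Sum>i\<in>A. c i * f i x) g = (\<Sum>i\<in>A. c i * L2_inner (f i) g)"
  unfolding L2_inner_def sum_distrib_right mult.assoc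
  using assms by (intro sphere_integral_sum continuous_intros)

lemma sphere_integral_const: "sphere_integral (\<lambda>_. c) = 4 * pi * c"
  by (simp add: sphere_integral_def measure_def space_surface_measure emeasure_surface_measure_S2)

lemma sphere_integral_orthogonal:
  assumes "continuous_on S2 f" "orthogonal_transformation R"
  shows "sphere_integral (\<lambda>x. f (R x)) = sphere_integral f"
  unfolding sphere_integral_def
  using integral_distr[OF orthogonal_transformation_measurable_surface_measure[OF assms(2)]
      measurable_surface_measure_continuous[OF assms(1)]]
  by (simp add: distr_surface_measure_orthogonal[OF assms(2)])

subsection \<open>Integrals of spherical harmonics\<close>

lemma continuous_on_spherical_harmonics:
  assumes "f \<in> spherical_harmonics l"
  shows "continuous_on S2 f"
proof -
  obtain p where p: "real_polynomial_function p" "\<And>x. x \<in> S2 \<Longrightarrow> f x = p x"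
    using assms by (auto simp: spherical_harmonics_def harmonic_homogeneous_polynomial_def)
  have "continuous_on S2 p"
    using continuous_real_polymonial_function[OF p(1)] continuous_at_imp_continuous_on by blast
  then show ?thesis
    using p(2) by (subst continuous_on_cong[OF refl, of S2 f p]) auto
qed

lemma spherical_harmonics_sum:
  assumes "finite A" "\<And>i. i \<in> A \<Longrightarrow> f i \<in> spherical_harmonics l"
  shows "(\<lambda>x. \<Sum>i\<in>A. c i * f i x) \<in> spherical_harmonics l"
proof -
  have "\<forall>i\<in>A. \<exists>p. harmonic_homogeneous_polynomial l p \<and> (\<forall>x\<in>S2. f i x = p x)"
    using assms(2) by (auto simp: spherical_harmonics_def)
  then obtain p where p: "\<And>i. i \<in> A \<Longrightarrow> harmonic_homogeneous_polynomial l (p i)"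
    "\<And>i x. i \<in> A \<Longrightarrow> x \<in> S2 \<Longrightarrow> f i x = p i x"
    by metis
  have "real_polynomial_function (\<lambda>x. \<Sum>i\<in>A. c i * p i x)"
    using p(1) assms(1) unfolding harmonic_homogeneous_polynomial_def
    by (intro real_polynomial_function_sum real_polynomial_function.intros(2,4)) auto
  then have "harmonic_homogeneous_polynomial l (\<lambda>x. \<Sum>i\<in>A. c i * p i x)"
    using p(1) assms(1) unfolding harmonic_homogeneous_polynomial_def
    by (auto simp: laplacian_sum sum_distrib_left mult.left_commute)
  moreover have "\<forall>x\<in>S2. (\<Sum>i\<in>A. c i * f i x) = (\<Sum>i\<in>A. c i * p i x)"
    using p(2) by (auto intro!: sum.cong)
  ultimately show ?thesis
    unfolding spherical_harmonics_def by blast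
qed

lemma spherical_harmonics_orthogonal:
  assumes f: "f \<in> spherical_harmonics l" and R: "orthogonal_transformation R"
  shows "(\<lambda>x. f (R x)) \<in> spherical_harmonics l"
proof -
  obtain p where p: "harmonic_homogeneous_polynomial l p" "\<And>x. x \<in> S2 \<Longrightarrow> f x = p x"
    using f by (auto simp: spherical_harmonics_def)
  have lin: "linear R"
    using R by (rule orthogonal_transformation_linear)
  have "real_polynomial_function (p \<circ> R)"
    using p(1) lin by (intro real_polynomial_function_compose polynomial_function_bounded_linear)
       (auto simp: harmonic_homogeneous_polynomial_def linear_linear)
  then have "harmonic_homogeneous_polynomial l (\<lambda>x. p (R x))"
    using p(1) unfolding harmonic_homogeneous_polynomial_def
    by (auto simp: o_def laplacian_orthogonal_transformation[OF _ R] linear_scale[OF lin])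
  moreover have "\<forall>x\<in>S2. f (R x) = p (R x)"
    using p(2) R by (auto simp: orthogonal_transformation_norm)
  ultimately show ?thesis
    unfolding spherical_harmonics_def by blast
qed

lemma const_spherical_harmonics_0: "(\<lambda>_. c) \<in> spherical_harmonics 0"
  by (auto simp: spherical_harmonics_def harmonic_homogeneous_polynomial_def laplacian_const
      intro!: exI[of _ "\<lambda>_. c"])

lemma spherical_harmonics_independent:
  assumes f: "\<And>l. l \<le> n \<Longrightarrow> f l \<in> spherical_harmonics l"
    and zero: "\<And>x. x \<in> S2 \<Longrightarrow> (\<Sum>l\<le>n. f l x) = 0"
    and x: "x \<in> S2" and l: "l \<le> n"
  shows "f l x = 0"
proof -
  have "\<forall>l. \<exists>p. l \<le> n \<longrightarrow> harmonic_homogeneous_polynomial l p \<and> (\<forall>x\<in>S2. f l x = p x)"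
    using f by (auto simp: spherical_harmonics_def)
  then obtain p where p: "\<And>l. l \<le> n \<Longrightarrow> harmonic_homogeneous_polynomial l (p l)"
    "\<And>l x. l \<le> n \<Longrightarrow> x \<in> S2 \<Longrightarrow> f l x = p l x"
    by metis
  have "p l x = 0"
    using zero p by (intro harmonic_homogeneous_independent[OF p(1) _ x l]) auto
  then show ?thesis
    using p(2) x l by simp
qed

text \<open>The function in degree \<open>l\<close> and the constant \<open>- c\<close> in degree
  \<open>0\<close> add up to zero on the sphere, and different degrees are independent.\<close>

lemma spherical_harmonics_const_eq_0:
  assumes f: "f \<in> spherical_harmonics l" "l \<ge> 1" and c: "\<And>x. x \<in> S2 \<Longrightarrow> f x = c"
    and x: "x \<in> S2"
  shows "f x = 0"
proof -
  define g where "g = (\<lambda>k x. if k = l then f x else if k = 0 then - c else (0::real))"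
  have g: "g k \<in> spherical_harmonics k" for k
  proof -
    have "(\<lambda>_. 0) \<in> spherical_harmonics k"
      using spherical_harmonics_sum[of "{}" "\<lambda>_ _. 0" k] by simp
    then show ?thesis
      using f const_spherical_harmonics_0[of "- c"]
      by (cases "k = l"; cases "k = 0") (auto simp: g_def)
  qed
  have "(\<Sum>k\<le>l. g k x) = 0" if "x \<in> S2" for x
  proof -
    have "(\<Sum>k\<le>l. g k x) = (\<Sum>k\<in>{0, l}. g k x)"
      by (rule sum.mono_neutral_right) (auto simp: g_def)
    then show ?thesis
      using f(2) c[OF that] by (simp add: g_def)
  qed
  from spherical_harmonics_independent[of l g, OF g this x order_refl] show ?thesis
    by (simp add: g_def)
qed

text \<open>The hypothesis gives orthonormality within the single degree \<open>l\<close>;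
  orthogonality to the constants has to come from the symmetry of the sphere.\<close>

lemma sphere_integral_spherical_harmonics:
  assumes y: "orthonormal_basis_of_harmonics l y" and l: "l \<ge> 1"
    and f: "f \<in> spherical_harmonics l"
  shows "sphere_integral f = 0"
proof -
  define K where "K = {- int l..int l}"
  have yh: "y k \<in> spherical_harmonics l" if "k \<in> K" for k
    using y that by (auto simp: orthonormal_basis_of_harmonics_def K_def)
  have orth: "L2_inner (y j) (y k) = (if j = k then 1 else 0)" if "j \<in> K" "k \<in> K" for j k
    using y that by (auto simp: orthonormal_basis_of_harmonics_def K_def)
  have span: "\<exists>c. \<forall>x\<in>S2. f x = (\<Sum>k\<in>K. c k * y k x)" if "f \<in> spherical_harmonics l" for f
    using y that unfolding orthonormal_basis_of_harmonics_def K_def by blast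
  have yc: "continuous_on S2 (y k)" if "k \<in> K" for k
    using yh[OF that] by (rule continuous_on_spherical_harmonics)
  have coeff: "c k = L2_inner f (y k)"
    if "\<And>x. x \<in> S2 \<Longrightarrow> f x = (\<Sum>k\<in>K. c k * y k x)" "k \<in> K" for f c k
  proof -
    have "L2_inner f (y k) = L2_inner (\<lambda>x. \<Sum>k\<in>K. c k * y k x) (y k)"
      using that(1) by (intro L2_inner_cong) auto
    also have "\<dots> = (\<Sum>j\<in>K. c j * L2_inner (y j) (y k))"
      using yc that by (intro L2_inner_sum_left)
    also have "\<dots> = c k"
      using that(2) by (simp add: orth if_distrib[of "\<lambda>t. _ * t"] K_def cong: if_cong)
    finally show ?thesis ..
  qed
  \<comment> \<open>Riesz representer of the integral\<close>
  define z where "z = (\<lambda>x. \<Sum>k\<in>K. sphere_integral (y k) * y k x)"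
  have z: "z \<in> spherical_harmonics l"
    unfolding z_def using yh by (intro spherical_harmonics_sum) (auto simp: K_def)
  have zc: "continuous_on S2 z"
    using z by (rule continuous_on_spherical_harmonics)
  have repr: "L2_inner z f = sphere_integral f" if f: "f \<in> spherical_harmonics l" for f
  proof -
    obtain c where c: "\<And>x. x \<in> S2 \<Longrightarrow> f x = (\<Sum>k\<in>K. c k * y k x)"
      using span[OF f] by meson
    have "sphere_integral f = (\<Sum>k\<in>K. c k * sphere_integral (y k))"
      using c yc by (subst sphere_integral_sum[symmetric]) (auto intro!: sphere_integral_cong)
    also have "\<dots> = (\<Sum>k\<in>K. sphere_integral (y k) * L2_inner (y k) f)"
    proof (intro sum.cong refl)
      fix k assume "k \<in> K"
      with c have "c k = L2_inner f (y k)"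
        by (rule coeff)
      then show "c k * sphere_integral (y k) = sphere_integral (y k) * L2_inner (y k) f"
        by (simp add: L2_inner_def mult.commute)
    qed
    also have "\<dots> = L2_inner z f"
      unfolding z_def using yc continuous_on_spherical_harmonics[OF f]
      by (intro L2_inner_sum_left[symmetric])
    finally show ?thesis ..
  qed
  \<comment> \<open>The coefficients of the rotated \<open>z\<close> are compared with those of
    \<open>z\<close>: the rotation is moved onto \<open>y k\<close>, where the integral absorbs
    it.\<close>
  have inv: "z (R x) = z x" if R: "orthogonal_transformation R" and x: "x \<in> S2" for R x
  proof -
    obtain d where d: "\<And>x. x \<in> S2 \<Longrightarrow> z (R x) = (\<Sum>k\<in>K. d k * y k x)"
      using span[OF spherical_harmonics_orthogonal[OF z R]] by meson
    have "d k = sphere_integral (y k)" if k: "k \<in> K" for k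
    proof -
      have iR: "orthogonal_transformation (inv R)"
        using R by (rule orthogonal_transformation_inv)
      have yk: "(\<lambda>x. y k (inv R x)) \<in> spherical_harmonics l"
        using yh[OF k] iR by (rule spherical_harmonics_orthogonal)
      have "d k = L2_inner (\<lambda>x. z (R x)) (y k)"
        using d k by (rule coeff)
      \<comment> \<open>Writing the argument of \<open>y k\<close> as \<open>inv R (R x)\<close>
        makes the integrand a function of \<open>R x\<close>, ready for the invariance of the
        integral.\<close>
      also have "\<dots> = sphere_integral (\<lambda>x. z (R x) * y k (inv R (R x)))"
        using orthogonal_transformation_inj[OF R] by (simp add: L2_inner_def)
      also have "\<dots> = L2_inner z (\<lambda>x. y k (inv R x))"
        unfolding L2_inner_def using zc continuous_on_spherical_harmonics[OF yk]
        by (intro sphere_integral_orthogonal[OF _ R] continuous_intros)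
      also have "\<dots> = sphere_integral (\<lambda>x. y k (inv R x))"
        using yk by (rule repr)
      also have "\<dots> = sphere_integral (y k)"
        using yc[OF k] iR by (rule sphere_integral_orthogonal)
      finally show ?thesis .
    qed
    then show ?thesis
      using d[OF x] by (simp add: z_def)
  qed
  obtain a :: "real ^ 3" where a: "norm a = 1"
    using vector_choose_size[of 1] by auto
  \<comment> \<open>Orthogonal maps act transitively on the sphere, so the invariant
    \<open>z\<close> is constant there.\<close>
  have "z x = z a" if x: "x \<in> S2" for x
  proof -
    have "norm x = 1"
      using x by simp
    with a obtain R where "orthogonal_transformation R" "R a = x"
      by (rule orthogonal_transformation_exists_1)
    then show ?thesis
      using inv[of R a] a by simp
  qed
  then have "z x = 0" if "x \<in> S2" for x
    using that by (rule spherical_harmonics_const_eq_0[OF z l])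
  then have "L2_inner z f = L2_inner (\<lambda>_. 0) f"
    by (intro L2_inner_cong) auto
  then show ?thesis
    using repr[OF f] by (simp add: L2_inner_def sphere_integral_const)
qed

subsection \<open>Quadrature formulas with prescribed values\<close>

text \<open>Induction on \<open>I\<close>, adding one node per function. The node set
  \<open>X\<close> is chosen before the values \<open>c\<close>, so that weights for all unit
  vectors live on the same nodes.\<close>

lemma point_functionals_span_dual:
  fixes f :: "'i \<Rightarrow> 'a \<Rightarrow> real"
  assumes "finite I"
    and "\<And>a. (\<And>x. x \<in> S \<Longrightarrow> (\<Sum>i\<in>I. a i * f i x) = 0) \<Longrightarrow> \<forall>i\<in>I. a i = 0"
  shows "\<exists>X. finite X \<and> X \<subseteq> S \<and> (\<forall>c. \<exists>w. \<forall>i\<in>I. (\<Sum>x\<in>X. w x * f i x) = c i)"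
  using assms
proof (induction I rule: finite_induct)
  case empty
  then show ?case
    by (intro exI[of _ "{}"]) auto
next
  case (insert j I)
  \<comment> \<open>Independence passes to the smaller family by giving \<open>f j\<close> the
    coefficient \<open>0\<close>.\<close>
  have "\<forall>i\<in>I. a i = 0" if "\<And>x. x \<in> S \<Longrightarrow> (\<Sum>i\<in>I. a i * f i x) = 0" for a
  proof -
    have "(\<Sum>i\<in>insert j I. (a(j := 0)) i * f i x) = (\<Sum>i\<in>I. a i * f i x)" for x
      using insert.hyps by (simp, intro sum.cong) auto
    then have "\<forall>i\<in>insert j I. (a(j := 0)) i = 0"
      using that by (intro insert.prems) simp
    then show ?thesis
      using insert.hyps by (auto split: if_splits)
  qed
  from insert.IH[OF this] obtain X where X: "finite X" "X \<subseteq> S"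
    and w: "\<And>c. \<exists>w. \<forall>i\<in>I. (\<Sum>x\<in>X. w x * f i x) = c i"
    by blast
  have "\<forall>i. \<exists>w. \<forall>k\<in>I. (\<Sum>x\<in>X. w x * f k x) = (if k = i then 1 else 0)"
    using w by (intro allI)
  \<comment> \<open>The weights \<open>u i\<close> are dual to the functions: they give
    \<open>1\<close> on \<open>f i\<close> and \<open>0\<close> on the others.\<close>
  then obtain u where u: "\<And>i k. k \<in> I \<Longrightarrow> (\<Sum>x\<in>X. u i x * f k x) = (if k = i then 1 else 0)"
    by metis
  \<comment> \<open>\<open>r x0\<close> is a combination of point evaluations that vanishes on the functions indexed by \<open>I\<close>.\<close>
  define r where "r = (\<lambda>x0 g. g x0 - (\<Sum>i\<in>I. f i x0 * (\<Sum>x\<in>X. u i x * g x)))"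
  have rI: "r x0 (f k) = 0" if "k \<in> I" for x0 k
    using that insert.hyps by (simp add: r_def u if_distrib[of "\<lambda>t. _ * t"] cong: if_cong)
  \<comment> \<open>Otherwise \<open>f j\<close> would be a combination of the other functions on
    \<open>S\<close>, a relation with coefficient \<open>1\<close> at \<open>j\<close>.\<close>
  have "\<exists>x0\<in>S. r x0 (f j) \<noteq> 0"
  proof (rule ccontr)
    assume "\<not> ?thesis"
    then have r0: "r x0 (f j) = 0" if "x0 \<in> S" for x0
      using that by blast
    define a where "a = (\<lambda>i. if i = j then 1 else - (\<Sum>x\<in>X. u i x * f j x))"
    have "(\<Sum>i\<in>insert j I. a i * f i x0) = r x0 (f j)" for x0
    proof -
      have "(\<Sum>i\<in>I. a i * f i x0) = (\<Sum>i\<in>I. - (f i x0 * (\<Sum>x\<in>X. u i x * f j x)))"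
        using insert.hyps by (intro sum.cong refl) (auto simp: a_def)
      then show ?thesis
        using insert.hyps by (simp add: r_def a_def sum_negf)
    qed
    then have "\<forall>i\<in>insert j I. a i = 0"
      using r0 by (intro insert.prems) simp
    then show False
      by (simp add: a_def)
  qed
  then obtain x0 where x0: "x0 \<in> S" "r x0 (f j) \<noteq> 0"
    by blast
  have "\<exists>w. \<forall>i\<in>insert j I. (\<Sum>x\<in>insert x0 X. w x * f i x) = c i" for c
  proof -
    obtain v where v: "\<And>i. i \<in> I \<Longrightarrow> (\<Sum>x\<in>X. v x * f i x) = c i"
      using w[of c] by blast
    \<comment> \<open>The error left by \<open>v\<close> at \<open>f j\<close>, divided by the value
      of the correcting functional there.\<close>
    define s where "s = (c j - (\<Sum>x\<in>X. v x * f j x)) / r x0 (f j)"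
    \<comment> \<open>The two contributions are added rather than split by cases, because
      \<open>x0\<close> may already belong to \<open>X\<close>.\<close>
    define w where "w = (\<lambda>x. (if x \<in> X then v x - s * (\<Sum>i\<in>I. f i x0 * u i x) else 0)
      + (if x = x0 then s else 0))"
    \<comment> \<open>The new weights add \<open>s * r x0\<close> to the old functional: the values
      on \<open>I\<close> stay, and the one at \<open>j\<close> is corrected.\<close>
    have w_eq: "(\<Sum>x\<in>insert x0 X. w x * g x) = (\<Sum>x\<in>X. v x * g x) + s * r x0 g" for g
    proof -
      have "(\<Sum>x\<in>insert x0 X. w x * g x) =
          (\<Sum>x\<in>insert x0 X. (if x \<in> X then v x - s * (\<Sum>i\<in>I. f i x0 * u i x) else 0) * g x)
          + (\<Sum>x\<in>insert x0 X. if x = x0 then s * g x else 0)"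
        unfolding sum.distrib[symmetric] by (intro sum.cong refl) (simp add: w_def distrib_right)
      also have "(\<Sum>x\<in>insert x0 X. if x = x0 then s * g x else 0) = s * g x0"
        using X(1) by (simp add: sum.delta)
      also have "(\<Sum>x\<in>insert x0 X. (if x \<in> X then v x - s * (\<Sum>i\<in>I. f i x0 * u i x) else 0) * g x)
          = (\<Sum>x\<in>X. (v x - s * (\<Sum>i\<in>I. f i x0 * u i x)) * g x)"
        using X(1) by (intro sum.mono_neutral_cong_right) auto
      also have "\<dots> = (\<Sum>x\<in>X. v x * g x) - s * (\<Sum>x\<in>X. \<Sum>i\<in>I. f i x0 * (u i x * g x))"
        by (simp add: left_diff_distrib sum_subtractf sum_distrib_left sum_distrib_right mult.assoc)
      also have "(\<Sum>x\<in>X. \<Sum>i\<in>I. f i x0 * (u i x * g x)) =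
          (\<Sum>i\<in>I. f i x0 * (\<Sum>x\<in>X. u i x * g x))"
        unfolding sum_distrib_left by (rule sum.swap)
      finally show ?thesis
        by (simp add: r_def right_diff_distrib)
    qed
    show ?thesis
    proof (intro exI[of _ w] ballI)
      fix i assume "i \<in> insert j I"
      then show "(\<Sum>x\<in>insert x0 X. w x * f i x) = c i"
        unfolding w_eq using x0(2) v rI by (cases "i = j") (auto simp: s_def)
    qed
  qed
  then show ?case
    using X x0(1) by (intro exI[of _ "insert x0 X"]) auto
qed

text \<open>Enumerating \<open>X\<close> bijectively gives pairwise distinct nodes; nonemptiness
  gives at least one.\<close>

lemma quadrature_formula_weighted_sum:
  assumes X: "finite X" "X \<noteq> {}" "X \<subseteq> S2"
  shows "quadrature_formula (\<lambda>f. \<Sum>x\<in>X. w x * f x)"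
proof -
  obtain h where h: "bij_betw h {1..card X} X"
    using ex_bij_betw_nat_finite_1[OF X(1)] by blast
  have "(\<Sum>x\<in>X. w x * f x) = (\<Sum>j=1..card X. w (h j) * f (h j))" for f :: "real ^ 3 \<Rightarrow> real"
    by (rule sum.reindex_bij_betw[OF h, symmetric])
  moreover have "card X \<ge> 1"
    using X by (simp add: Suc_le_eq card_gt_0_iff)
  ultimately show ?thesis
    unfolding quadrature_formula_def using h X(3)
    by (intro exI[of _ "card X"] conjI exI[of _ h] exI[of _ "\<lambda>j. w (h j)"])
       (auto simp: bij_betw_def)
qed

text \<open>Independence of the degrees makes each block \<open>f l\<close> vanish on the sphere;
  orthonormality within the block then isolates each coefficient.\<close>

lemma orthonormal_bases_independent:
  assumes Y: "\<forall>l. orthonormal_basis_of_harmonics l (Y l)"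
    and zero: "\<And>x. x \<in> S2 \<Longrightarrow> (\<Sum>(l, k)\<in>(SIGMA l:{..n}. {- int l..int l}). a (l, k) * Y l k x) = 0"
    and l: "l \<le> n" and k: "k \<in> {- int l..int l}"
  shows "a (l, k) = 0"
proof -
  define f where "f = (\<lambda>l x. \<Sum>k\<in>{- int l..int l}. a (l, k) * Y l k x)"
  have Yh: "Y l k \<in> spherical_harmonics l" if "k \<in> {- int l..int l}" for l k
    using Y that by (auto simp: orthonormal_basis_of_harmonics_def)
  have f: "f l \<in> spherical_harmonics l" for l
    unfolding f_def using Yh by (intro spherical_harmonics_sum) auto
  have "(\<Sum>l\<le>n. f l x) = 0" if "x \<in> S2" for x
    using zero[OF that] by (simp add: f_def sum.Sigma)
  then have "f l x = 0" if "x \<in> S2" for x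
    using f l that by (intro spherical_harmonics_independent[of n f]) auto
  then have "0 = L2_inner (f l) (Y l k)"
    by (subst L2_inner_cong[of "f l" "\<lambda>_. 0" "Y l k" "Y l k"])
       (auto simp: L2_inner_def sphere_integral_const)
  also have "\<dots> = (\<Sum>j\<in>{- int l..int l}. a (l, j) * L2_inner (Y l j) (Y l k))"
    unfolding f_def using continuous_on_spherical_harmonics[OF Yh] k
    by (intro L2_inner_sum_left) auto
  also have "\<dots> = (\<Sum>j\<in>{- int l..int l}. if j = k then a (l, j) else 0)"
    using Y k by (intro sum.cong refl) (auto simp: orthonormal_basis_of_harmonics_def)
  also have "\<dots> = a (l, k)"
    using k by (simp add: sum.delta)
  finally show ?thesis ..
qed

lemma exists_quadrature_prescribed_values:
  assumes Y: "\<forall>l. orthonormal_basis_of_harmonics l (Y l)"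
  shows "\<exists>X w. finite X \<and> X \<subseteq> S2 \<and>
    (\<forall>l\<le>n. \<forall>k\<in>{- int l..int l}. (\<Sum>x\<in>X. w x * Y l k x) = T l k)"
proof -
  let ?I = "SIGMA l:{..n}. {- int l..int l}"
  have "\<forall>i\<in>?I. a i = 0"
    if a: "\<And>x. x \<in> S2 \<Longrightarrow> (\<Sum>i\<in>?I. a i * (case i of (l, k) \<Rightarrow> Y l k) x) = 0" for a
  proof -
    have "(\<Sum>(l, k)\<in>?I. a (l, k) * Y l k x) = 0" if x: "x \<in> S2" for x
      using a[OF x] by (simp add: case_prod_beta)
    then show ?thesis
      using orthonormal_bases_independent[OF Y, where n = n and a = a] by auto
  qed
  then have "\<exists>X. finite X \<and> X \<subseteq> S2 \<and>
      (\<forall>c. \<exists>w. \<forall>i\<in>?I. (\<Sum>x\<in>X. w x * (case i of (l, k) \<Rightarrow> Y l k) x) = c i)"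
    by (intro point_functionals_span_dual) auto
  then obtain X where "finite X" "X \<subseteq> S2"
    "\<And>c. \<exists>w. \<forall>i\<in>?I. (\<Sum>x\<in>X. w x * (case i of (l, k) \<Rightarrow> Y l k) x) = c i"
    by blast
  moreover from this(3)[of "\<lambda>(l, k). T l k"] obtain w where
    "\<forall>i\<in>?I. (\<Sum>x\<in>X. w x * (case i of (l, k) \<Rightarrow> Y l k) x) = (case i of (l, k) \<Rightarrow> T l k)"
    by blast
  ultimately show ?thesis
    by (intro exI[of _ X] exI[of _ w]) auto
qed

section \<open>Construction of the quadrature sequence\<close>

theorem proposition4p7:
  fixes Y :: "nat \<Rightarrow> int \<Rightarrow> real ^ 3 \<Rightarrow> real"
  assumes "\<forall>l. orthonormal_basis_of_harmonics l (Y l)"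
  shows "\<exists>Q :: nat \<Rightarrow> (real ^ 3 \<Rightarrow> real) \<Rightarrow> real.
           (\<forall>n\<ge>1. quadrature_formula (Q n)) \<and>
           (\<forall>p\<in>sphere_polynomials. (\<lambda>n. \<bar>Q n p - sphere_integral p\<bar>) \<longlonglongrightarrow> 0) \<and>
           (\<forall>n\<ge>1. L2_norm (\<lambda>x. hyperinterpolation Y n (Q n) (\<lambda>_. 1) x - 1) = 1)"
proof -
  have Yh: "Y l k \<in> spherical_harmonics l" if "k \<in> {- int l..int l}" for l k
    using assms that by (auto simp: orthonormal_basis_of_harmonics_def)
  have Yc: "continuous_on S2 (Y l k)" if "k \<in> {- int l..int l}" for l k
    using Yh[OF that] by (rule continuous_on_spherical_harmonics)
  have Y1: "L2_inner (Y l 0) (Y l 0) = 1" for l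
    using assms by (auto simp: orthonormal_basis_of_harmonics_def)
  have span: "\<exists>c. \<forall>x\<in>S2. f x = (\<Sum>k=- int l..int l. c k * Y l k x)"
    if "f \<in> spherical_harmonics l" for f l
    using assms that unfolding orthonormal_basis_of_harmonics_def by blast
  \<comment> \<open>Degree \<open>0\<close> has the single index \<open>0\<close>, so the constant
    \<open>1\<close> is a multiple of \<open>Y 0 0\<close>.\<close>
  obtain c where c: "\<And>x. x \<in> S2 \<Longrightarrow> 1 = c * Y 0 0 x"
  proof -
    obtain d where "\<And>x. x \<in> S2 \<Longrightarrow> 1 = (\<Sum>k=- int 0..int 0. d k * Y 0 k x)"
      using span[OF const_spherical_harmonics_0[of 1]] by meson
    then show ?thesis
      by (intro that[of "d 0"]) simp
  qed
  \<comment> \<open>Inserting \<open>1 = c * Y 0 0\<close> under the integral leaves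
    \<open>c\<close> times the squared norm of \<open>Y 0 0\<close>, which is
    \<open>1\<close>.\<close>
  have IY0: "sphere_integral (Y 0 0) = c"
  proof -
    have "sphere_integral (Y 0 0) = sphere_integral (\<lambda>x. c * (Y 0 0 x * Y 0 0 x))"
      using c by (intro sphere_integral_cong) (metis mult.assoc mult_1)
    also have "\<dots> = c"
      using Y1[of 0] by (simp add: L2_inner_def sphere_integral_def)
    finally show ?thesis .
  qed
  have "c \<noteq> 0"
    using c vector_choose_size[of 1] by (metis mem_sphere_0 mult_zero_left zero_neq_one zero_le_one)
  \<comment> \<open>The value in degree \<open>0\<close> is the exact integral; the \<open>1\<close>
    at degree \<open>n\<close> and index \<open>0\<close> is the deliberate error. For
    \<open>n = 0\<close> the first case takes precedence, and the norm claim starts at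
    \<open>n = 1\<close>.\<close>
  define T :: "nat \<Rightarrow> nat \<Rightarrow> int \<Rightarrow> real"
    where "T = (\<lambda>n l k. if l = 0 then c else if l = n \<and> k = 0 then 1 else 0)"
  have "\<forall>n. \<exists>X w. finite X \<and> X \<subseteq> S2 \<and>
      (\<forall>l\<le>n. \<forall>k\<in>{- int l..int l}. (\<Sum>x\<in>X. w x * Y l k x) = T n l k)"
    using exists_quadrature_prescribed_values[OF assms] by blast
  then obtain X w where X: "\<And>n. finite (X n)" "\<And>n. X n \<subseteq> S2"
    and w: "\<And>n l k. l \<le> n \<Longrightarrow> k \<in> {- int l..int l} \<Longrightarrow> (\<Sum>x\<in>X n. w n x * Y l k x) = T n l k"
    by metis
  define Q where "Q = (\<lambda>n f. \<Sum>x\<in>X n. w n x * f x)"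
  have QY: "Q n (Y l k) = T n l k" if "l \<le> n" "k \<in> {- int l..int l}" for n l k
    using w[OF that] by (simp add: Q_def)
  \<comment> \<open>An empty node set would give \<open>Y 0 0\<close> the value \<open>0\<close>
    instead of \<open>c\<close>.\<close>
  have "X n \<noteq> {}" for n
    using QY[of 0 n 0] \<open>c \<noteq> 0\<close> by (auto simp: Q_def T_def)
  then have quad: "quadrature_formula (Q n)" for n
    unfolding Q_def using X by (intro quadrature_formula_weighted_sum)
  have lim: "(\<lambda>n. \<bar>Q n p - sphere_integral p\<bar>) \<longlonglongrightarrow> 0" if p_poly: "p \<in> sphere_polynomials" for p
  proof -
    obtain m g where g: "\<And>l. l \<le> m \<Longrightarrow> g l \<in> spherical_harmonics l"
      "\<And>x. x \<in> S2 \<Longrightarrow> p x = (\<Sum>l\<le>m. g l x)"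
      using p_poly unfolding sphere_polynomials_def sphere_polynomials_upto_def by blast
    have "\<forall>l. \<exists>c. l \<le> m \<longrightarrow> (\<forall>x\<in>S2. g l x = (\<Sum>k=- int l..int l. c k * Y l k x))"
      using span g(1) by blast
    then obtain a where "\<And>l x. l \<le> m \<Longrightarrow> x \<in> S2 \<Longrightarrow> g l x = (\<Sum>k=- int l..int l. a l k * Y l k x)"
      by metis
    \<comment> \<open>The factor \<open>1\<close> gives the outer sum the shape required by
      \<open>sphere_integral_sum\<close>.\<close>
    then have p: "p x = (\<Sum>l\<le>m. 1 * (\<Sum>k=- int l..int l. a l k * Y l k x))" if "x \<in> S2" for x
      using g(2) that by simp
    \<comment> \<open>Once \<open>n\<close> exceeds the degree bound \<open>m\<close>, the error in
      degree \<open>n\<close> is invisible to \<open>p\<close>, so the sequence of errors is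
      eventually zero.\<close>
    have "Q n p = sphere_integral p" if n: "n > m" for n
    proof -
      have "Q n p = (\<Sum>l\<le>m. \<Sum>k=- int l..int l. a l k * Q n (Y l k))"
      proof -
        have "Q n p = (\<Sum>x\<in>X n. \<Sum>l\<le>m. \<Sum>k=- int l..int l. a l k * (w n x * Y l k x))"
          unfolding Q_def using p X(2)
          by (intro sum.cong refl) (simp add: subset_iff sum_distrib_left mult.left_commute)
        also have "\<dots> = (\<Sum>l\<le>m. \<Sum>k=- int l..int l. \<Sum>x\<in>X n. a l k * (w n x * Y l k x))"
          by (subst sum.swap) (intro sum.cong refl sum.swap)
        finally show ?thesis
          by (simp add: Q_def sum_distrib_left)
      qed
      also have "\<dots> = (\<Sum>l\<le>m. \<Sum>k=- int l..int l. a l k * sphere_integral (Y l k))"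
      proof (intro sum.cong refl)
        fix l k assume lk: "l \<in> {..m}" "k \<in> {- int l..int l}"
        have "T n l k = sphere_integral (Y l k)"
        proof (cases "l = 0")
          case True
          with lk show ?thesis
            by (simp add: T_def IY0)
        next
          case False
          then have "sphere_integral (Y l k) = 0"
            using assms Yh[OF lk(2)] by (intro sphere_integral_spherical_harmonics[of l "Y l"]) auto
          with False lk n show ?thesis
            by (simp add: T_def)
        qed
        then show "a l k * Q n (Y l k) = a l k * sphere_integral (Y l k)"
          using QY[of l n k] lk n by simp
      qed
      also have "\<dots> = (\<Sum>l\<le>m. 1 * sphere_integral (\<lambda>x. \<Sum>k=- int l..int l. a l k * Y l k x))"
        by (intro sum.cong refl) (subst sphere_integral_sum, auto intro: Yc)
      also have "\<dots> = sphere_integral (\<lambda>x. \<Sum>l\<le>m. 1 * (\<Sum>k=- int l..int l. a l k * Y l k x))"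
        using Yc by (intro sphere_integral_sum[symmetric] continuous_intros) auto
      also have "\<dots> = sphere_integral p"
        using p by (intro sphere_integral_cong) simp
      finally show ?thesis .
    qed
    then have "\<forall>\<^sub>F n in sequentially. \<bar>Q n p - sphere_integral p\<bar> = 0"
      unfolding eventually_sequentially by (intro exI[of _ "Suc m"]) auto
    then show ?thesis
      by (rule tendsto_eventually)
  qed
  have norm1: "L2_norm (\<lambda>x. hyperinterpolation Y n (Q n) (\<lambda>_. 1) x - 1) = 1" if n: "n \<ge> 1" for n
  proof -
    have "hyperinterpolation Y n (Q n) (\<lambda>_. 1) x - 1 = Y n 0 x" if x: "x \<in> S2" for x
    proof -
      have "hyperinterpolation Y n (Q n) (\<lambda>_. 1) x =
          (\<Sum>l=0..n. \<Sum>k=- int l..int l. T n l k * Y l k x)"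
        unfolding hyperinterpolation_def by (intro sum.cong refl) (simp add: QY)
      \<comment> \<open>Degree \<open>0\<close> reproduces the constant \<open>1\<close> and degree
        \<open>n\<close> adds \<open>Y n 0\<close>; the two degrees differ because \<open>n\<close>
        is at least \<open>1\<close>.\<close>
      also have "\<dots> = (\<Sum>l=0..n. (if l = 0 then 1 else 0) + (if l = n then Y l 0 x else 0))"
      proof (intro sum.cong refl)
        fix l
        have "(\<Sum>k=- int l..int l. T n l k * Y l k x) =
            (\<Sum>k=- int l..int l. if k = 0 then (if l = n then Y l k x else 0) else 0)" if "l \<noteq> 0"
          using that by (intro sum.cong refl) (auto simp: T_def)
        then show "(\<Sum>k=- int l..int l. T n l k * Y l k x) =
            (if l = 0 then 1 else 0) + (if l = n then Y l 0 x else 0)"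
          using c[OF x] n by (cases "l = 0") (auto simp: T_def)
      qed
      also have "\<dots> = 1 + Y n 0 x"
        by (simp add: sum.distrib)
      finally show ?thesis
        by simp
    qed
    then have "L2_norm (\<lambda>x. hyperinterpolation Y n (Q n) (\<lambda>_. 1) x - 1) = L2_norm (Y n 0)"
      unfolding L2_norm_def by (intro arg_cong[of _ _ sqrt] sphere_integral_cong) auto
    also have "\<dots> = 1"
      using Y1[of n] by (simp add: L2_norm_def L2_inner_def power2_eq_square)
    finally show ?thesis .
  qed
  from quad lim norm1 show ?thesis
    by blast
qed

end
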